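(* In $\Sigma=\mathrm{PG}(n,2)$, let $S$ be a cap which meets a hyperplane $K_C$ of $\Sigma$ in a single point $c_0$. Choose a subspace $H_\infty\subset K_C$ of codimension $2$ in $\Sigma$ disjoint from $S$. Let $K_A,K_B$ be the other two hyperplanes containing $H_\infty$, $H_A=K_A\setminus H_\infty$, $H_B=K_B\setminus H_\infty$, $A=S\cap H_A$, $B=S\cap H_B$, $B'=H_B\setminus B$. Suppose $B'=c_0+A$ and $|A|\neq 2^{n-2}$. Then $S$ is complete if and only if $A$ is not periodic, if and only if $B$ is not periodic.
   Context: Points of $\mathrm{PG}(n,2)$ are the nonzero vectors of $\mathbb{F}_2^{n+1}$; three distinct points $x,y,z$ are collinear iff $x+y=z$. A cap is a set of points with no three collinear; it is complete if not properly contained in another cap. $z+X=\{z+x:x\in X\}$. A set $X$ is periodic if some point $v$ satisfies $v+X=X$.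
   Formalization: The formal theorem assumes n ≥ 2; for n = 1 the claim is false (H_∞ and A empty, B = H_B = {b}, S = {b, c_0} is complete, yet A is vacuously periodic and B is not), and every n = 1 configuration fails. *)

theory Defs
  imports "HOL-Analysis.Cartesian_Space" "HOL-Library.Z2"
begin

text \<open>
  PG(n,2) is modelled over the coordinate space \<open>bit ^ 'd\<close>, with \<open>CARD('d) = n + 1\<close>.  Since the
  only nonzero scalar is 1, the points are the nonzero vectors themselves.
\<close>

definition pg_points :: "(bit ^ 'd) set"
  where "pg_points = {v. v \<noteq> 0}"

definition pg_collinear :: "bit ^ 'd \<Rightarrow> bit ^ 'd \<Rightarrow> bit ^ 'd \<Rightarrow> bool"
  where "pg_collinear x y z \<longleftrightarrow> x + y = z"

definition pg_cap :: "(bit ^ 'd) set \<Rightarrow> bool"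
  where "pg_cap X \<longleftrightarrow> X \<subseteq> pg_points \<and>
    (\<forall>x\<in>X. \<forall>y\<in>X. \<forall>z\<in>X. x \<noteq> y \<and> y \<noteq> z \<and> x \<noteq> z \<longrightarrow> \<not> pg_collinear x y z)"

definition pg_complete_cap :: "(bit ^ 'd) set \<Rightarrow> bool"
  where "pg_complete_cap X \<longleftrightarrow> pg_cap X \<and> \<not> (\<exists>Y. pg_cap Y \<and> X \<subset> Y)"

text \<open>
  A projective subspace is a set of points, so it does not contain 0; adjoining 0 gives the
  underlying linear subspace.  Its codimension in PG(n,2) is that of the linear subspace.
\<close>

definition pg_subspace :: "(bit ^ 'd) set \<Rightarrow> bool"
  where "pg_subspace U \<longleftrightarrow> U \<subseteq> pg_points \<and> vec.subspace (insert 0 U)"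

definition pg_codim :: "(bit ^ 'd) set \<Rightarrow> nat"
  where "pg_codim U = CARD('d) - vec.dim (insert 0 U)"

definition pg_hyperplane :: "(bit ^ 'd) set \<Rightarrow> bool"
  where "pg_hyperplane K \<longleftrightarrow> pg_subspace K \<and> pg_codim K = 1"

text \<open>The period is required to be a point, hence nonzero; in particular the empty set is periodic.\<close>

definition pg_periodic :: "(bit ^ 'd) set \<Rightarrow> bool"
  where "pg_periodic X \<longleftrightarrow> (\<exists>v\<in>pg_points. (+) v ` X = X)"

end

(* The complement of H_inf splits into three cosets H_A, H_B, H_C of the linear subspace
   W = H_inf + {0}, and S = A + B + {c0} (disjoint unions).  A point of H_A or H_B outside S is
   covered by a secant through c0, because B is the complement of c0 + A.  Since |A| and |B| are
   different and add up to |H_A| = |H_B| = |W|, one of them contains more than half of its coset,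
   hence meets each of its translates by W; so the points of H_inf are covered.  A point c0 + h
   of H_C with h in W, h nonzero, lies only on secants joining A to B, and it lies on none of
   them exactly when h + A is contained in A. *)
theory Submission
  imports Defs
begin

lemma UNIV_bit: "(UNIV :: bit set) = {0, 1}"
  by auto

lemma vec_bit_add_self [simp]: "(x :: bit ^ 'd) + x = 0"
  by (simp add: vec_eq_iff)

lemma vec_bit_add_self_left [simp]: "x + (x + y) = (y :: bit ^ 'd)"
  by (simp add: add.assoc [symmetric])

lemma vec_bit_add_cancel_outer [simp]: "x + (y + x) = (y :: bit ^ 'd)"
  by (simp add: add.commute [of y])

lemma mem_translate_iff: "y \<in> (+) v ` X \<longleftrightarrow> v + y \<in> (X :: (bit ^ 'd) set)"
  by (metis image_iff vec_bit_add_self_left)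

text \<open>The only scalars are 0 and 1, so adjoining an independent \<open>a\<close> replaces the
  span by its union with its translate by \<open>a\<close>. The two are disjoint since
  \<open>a\<close> is not in the old span, so the size doubles.\<close>

lemma card_span_bit:
  assumes "finite X" "vec.independent (X :: (bit ^ 'd) set)"
  shows "finite (vec.span X) \<and> card (vec.span X) = 2 ^ card X"
  using assms
proof (induction X rule: finite_induct)
  case empty
  then show ?case by simp
next
  case (insert a X)
  have a: "a \<notin> vec.span X" and X: "vec.independent X"
    using insert.prems insert.hyps by (auto simp: vec.independent_insert)
  have "vec.span (insert a X) = vec.span X \<union> (+) a ` vec.span X"
  proof -
    have "x \<in> vec.span (insert a X) \<longleftrightarrow> x \<in> vec.span X \<or> x - a \<in> vec.span X" for x
    proof -
      have "(\<exists>k::bit. x - k *s a \<in> vec.span X) \<longleftrightarrow> (\<exists>k\<in>{0,1::bit}. x - k *s a \<in> vec.span X)"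
        unfolding UNIV_bit [symmetric] by simp
      then show ?thesis by (simp add: vec.span_insert)
    qed
    moreover have "x - a \<in> vec.span X \<longleftrightarrow> x \<in> (+) a ` vec.span X" for x
      by (metis add.commute diff_eq_eq mem_translate_iff vec_bit_add_self_left)
    ultimately show ?thesis by blast
  qed
  moreover have "vec.span X \<inter> (+) a ` vec.span X = {}"
    using a vec.span_add_eq2 by blast
  ultimately show ?case
    using insert.IH [OF X] insert.hyps by (simp add: card_Un_disjoint card_image)
qed

lemma card_subspace_bit:
  assumes "vec.subspace (U :: (bit ^ 'd) set)"
  shows "card U = 2 ^ vec.dim U"
proof -
  obtain X where X: "X \<subseteq> U" "vec.independent X" "U \<subseteq> vec.span X" "card X = vec.dim U"
    using vec.basis_exists [of U] by blast
  have "vec.span X = U"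
    using X assms vec.span_subspace by blast
  then show ?thesis
    using card_span_bit [OF vec.finiteI_independent [OF X(2)] X(2)] X(4) by auto
qed

text \<open>\<open>card\<close> is 0 on infinite sets, whereas the whole space has a power of 2 as
  its cardinality.\<close>

lemma finite_bit_vec_set [simp]: "finite (X :: (bit ^ 'd) set)"
proof -
  have "card (UNIV :: (bit ^ 'd) set) \<noteq> 0"
    by (simp add: UNIV_bit)
  then have "finite (UNIV :: (bit ^ 'd) set)"
    by (rule card_ge_0_finite [OF neq0_conv [THEN iffD1]])
  then show ?thesis
    by (rule finite_subset [rotated]) simp
qed

text \<open>\<open>pg_codim\<close> uses truncated subtraction; a nonzero value \<open>k\<close>
  rules out truncation, so the dimension can be read off from it.\<close>

lemma card_pg_subspace:
  assumes "pg_subspace (U :: (bit ^ 'd) set)" "pg_codim U = k" "CARD('d) = n + k" "k \<noteq> 0"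
  shows "card (insert 0 U) = 2 ^ n"
proof -
  have "vec.dim (insert 0 U) = n"
    using assms unfolding pg_codim_def by linarith
  then show ?thesis
    using assms(1) card_subspace_bit by (metis pg_subspace_def)
qed

text \<open>The translate \<open>x + W\<close> lies in \<open>K - W\<close> and has the same number
  of elements, hence fills it.\<close>

lemma index_two_coset:
  fixes W K :: "(bit ^ 'd) set"
  assumes W: "vec.subspace W" and K: "vec.subspace K" "W \<subseteq> K" "card K = 2 * card W"
    and x: "x \<in> K - W"
  shows "y \<in> K - W \<longleftrightarrow> x + y \<in> W"
proof -
  have "(+) x ` W \<subseteq> K - W"
    using x K(1,2) W by (auto simp: vec.subspace_add)
       (metis add.commute vec.subspace_add vec_bit_add_cancel_outer)
  moreover have "card ((+) x ` W) = card (K - W)"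
    using K(2,3) by (simp add: card_image card_Diff_subset)
  ultimately have "(+) x ` W = K - W"
    by (simp add: card_subset_eq)
  then show ?thesis
    by (metis mem_translate_iff)
qed

text \<open>Translation by \<open>v\<close> is an involution, so mapping \<open>X\<close> into
  itself already means mapping it onto itself.\<close>

lemma pg_periodic_iff:
  fixes X :: "(bit ^ 'd) set"
  shows "pg_periodic X \<longleftrightarrow> (\<exists>v. v \<noteq> 0 \<and> (\<forall>x\<in>X. v + x \<in> X))"
proof -
  have "(+) v ` X = X \<longleftrightarrow> (\<forall>x\<in>X. v + x \<in> X)" for v :: "bit ^ 'd"
    by (auto simp: image_iff) (metis vec_bit_add_self_left)
  then show ?thesis
    by (auto simp: pg_periodic_def pg_points_def)
qed

text \<open>As 0 is not in \<open>X\<close>, the sum \<open>x + y\<close> automatically differs from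
  \<open>x\<close> and from \<open>y\<close>.\<close>

lemma pg_cap_iff:
  fixes X :: "(bit ^ 'd) set"
  shows "pg_cap X \<longleftrightarrow> 0 \<notin> X \<and> (\<forall>x\<in>X. \<forall>y\<in>X. x \<noteq> y \<longrightarrow> x + y \<notin> X)"
proof -
  have "y \<noteq> x + y \<and> x \<noteq> x + y" if "0 \<notin> X" "x \<in> X" "y \<in> X" for x y
    using that by auto
  moreover have "X \<subseteq> {v. v \<noteq> 0} \<longleftrightarrow> 0 \<notin> X" by auto
  ultimately show ?thesis
    unfolding pg_cap_def pg_points_def pg_collinear_def by metis
qed

text \<open>A point \<open>w\<close> outside \<open>S\<close> can be added to the cap exactly when
  it lies on no secant; \<open>x\<close> and \<open>w + x\<close> are the two points of
  \<open>S\<close> on a secant through \<open>w\<close>.\<close>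

lemma pg_complete_cap_iff:
  fixes S :: "(bit ^ 'd) set"
  assumes "pg_cap S"
  shows "pg_complete_cap S \<longleftrightarrow> (\<forall>w. w \<noteq> 0 \<longrightarrow> w \<notin> S \<longrightarrow> (\<exists>x\<in>S. w + x \<in> S))"
proof
  assume complete: "pg_complete_cap S"
  show "\<forall>w. w \<noteq> 0 \<longrightarrow> w \<notin> S \<longrightarrow> (\<exists>x\<in>S. w + x \<in> S)"
  proof (intro allI impI, rule ccontr)
    fix w assume w: "w \<noteq> 0" "w \<notin> S" "\<not> (\<exists>x\<in>S. w + x \<in> S)"
    have "x + y \<noteq> w" if "x \<in> S" "y \<in> S" for x y
      using that w(3) by (metis add.commute vec_bit_add_self_left)
    then have "pg_cap (insert w S)"
      using assms w unfolding pg_cap_iff by (auto simp: add.commute)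
    then show False
      using complete w(2) unfolding pg_complete_cap_def by blast
  qed
next
  assume *: "\<forall>w. w \<noteq> 0 \<longrightarrow> w \<notin> S \<longrightarrow> (\<exists>x\<in>S. w + x \<in> S)"
  have False if Y: "pg_cap Y" "S \<subset> Y" for Y
  proof -
    obtain w where w: "w \<in> Y" "w \<notin> S" using Y by blast
    then obtain x where "x \<in> S" "w + x \<in> S"
      using * Y unfolding pg_cap_iff by metis
    then show False
      using Y w unfolding pg_cap_iff by (metis psubsetD)
  qed
  then show "pg_complete_cap S"
    using assms unfolding pg_complete_cap_def by blast
qed

text \<open>Otherwise \<open>X\<close> and \<open>w + X\<close> would be disjoint subsets of
  \<open>H\<close>, with more elements together than \<open>H\<close> has.\<close>

lemma exists_translate_pair:
  fixes H X :: "(bit ^ 'd) set"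
  assumes "X \<subseteq> H" "card H < 2 * card X" "\<And>x. x \<in> H \<Longrightarrow> w + x \<in> H"
  shows "\<exists>x\<in>X. w + x \<in> X"
proof (rule ccontr)
  assume "\<not> ?thesis"
  then have "X \<inter> (+) w ` X = {}" by auto
  then have "card (X \<union> (+) w ` X) = 2 * card X"
    by (simp add: card_Un_disjoint card_image)
  moreover have "card (X \<union> (+) w ` X) \<le> card H"
    using assms by (intro card_mono) auto
  ultimately show False using assms(2) by simp
qed

theorem theorem3p5:
  fixes n :: nat
    and S K_A K_B K_C H_inf H_A H_B A B B' :: "(bit ^ 'd) set"
    and c0 :: "bit ^ 'd"
  assumes dimension: "CARD('d) = n + 1" "n \<ge> 2"
    and cap: "pg_cap S"
    and K_C: "pg_hyperplane K_C" "S \<inter> K_C = {c0}"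
    and H_inf: "pg_subspace H_inf" "pg_codim H_inf = 2" "H_inf \<subseteq> K_C" "H_inf \<inter> S = {}"
    and K_A: "pg_hyperplane K_A" "H_inf \<subseteq> K_A"
    and K_B: "pg_hyperplane K_B" "H_inf \<subseteq> K_B"
    and distinct_hyperplanes: "K_A \<noteq> K_C" "K_B \<noteq> K_C" "K_A \<noteq> K_B"
    and H_A: "H_A = K_A - H_inf"
    and H_B: "H_B = K_B - H_inf"
    and A: "A = S \<inter> H_A"
    and B: "B = S \<inter> H_B"
    and B': "B' = H_B - B"
    and B'_translate: "B' = (+) c0 ` A"
    and card_A: "card A \<noteq> 2 ^ (n - 2)"
  shows "(pg_complete_cap S \<longleftrightarrow> \<not> pg_periodic A) \<and> (\<not> pg_periodic A \<longleftrightarrow> \<not> pg_periodic B)"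
proof -

  \<comment> \<open>The space as a union of four cosets of \<open>W\<close>\<close>
  define W where "W = insert 0 H_inf"
  define H_C where "H_C = K_C - H_inf"
  have W: "vec.subspace W" "0 \<in> W" and cW: "card W = 2 ^ (n - 1)"
    using H_inf(1) card_pg_subspace [OF H_inf(1,2), of "n - 1"] dimension
    by (auto simp: W_def pg_subspace_def)
  \<comment> \<open>With 0 adjoined, \<open>K\<close> has twice as many elements as
    \<open>W\<close>, so its part outside \<open>H_inf\<close> is a single coset of
    \<open>W\<close>.\<close>
  have coset: "card (K - H_inf) = 2 ^ (n - 1)"
      "x \<in> K - H_inf \<Longrightarrow> y \<in> K - H_inf \<longleftrightarrow> x + y \<in> W"
    if K: "pg_hyperplane K" "H_inf \<subseteq> K" for K x y
  proof -
    have K': "pg_subspace K" "pg_codim K = 1"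
      using K(1) by (auto simp: pg_hyperplane_def)
    then have sub: "vec.subspace (insert 0 K)" and "0 \<notin> K"
      by (auto simp: pg_subspace_def pg_points_def)
    then have eq: "insert 0 K - W = K - H_inf" and WK: "W \<subseteq> insert 0 K"
      using K(2) by (auto simp: W_def)
    have cK: "card (insert 0 K) = 2 * card W"
      unfolding cW card_pg_subspace [OF K' dimension(1) one_neq_zero]
      using dimension(2) by (simp flip: power_Suc)
    show "card (K - H_inf) = 2 ^ (n - 1)"
      unfolding eq [symmetric] using cK WK cW by (simp add: card_Diff_subset)
    show "x \<in> K - H_inf \<Longrightarrow> y \<in> K - H_inf \<longleftrightarrow> x + y \<in> W"
      using index_two_coset [OF W(1) sub WK cK] unfolding eq by blast
  qed
  note cA = coset [OF K_A, folded H_A] and cB = coset [OF K_B, folded H_B]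
    and cC = coset [OF K_C(1) H_inf(3), folded H_C_def]
  \<comment> \<open>Two cosets of \<open>W\<close> with a common element coincide, and adding
    \<open>H_inf\<close> to both would give \<open>K = L\<close>.\<close>
  have disj: "(K - H_inf) \<inter> (L - H_inf) = {}"
    if "pg_hyperplane K" "H_inf \<subseteq> K" "pg_hyperplane L" "H_inf \<subseteq> L" "K \<noteq> L" for K L
    using coset(2) [OF that(1,2)] coset(2) [OF that(3,4)] that(2,4,5) by blast
  have AB: "H_A \<inter> H_B = {}" and AC: "H_A \<inter> H_C = {}" and BC: "H_B \<inter> H_C = {}"
    using disj K_A K_B K_C(1) H_inf(3) distinct_hyperplanes unfolding H_A H_B H_C_def by metis+
  have "0 \<notin> K_A" "0 \<notin> K_B" "0 \<notin> K_C"
    using K_A K_B K_C by (auto simp: pg_hyperplane_def pg_subspace_def pg_points_def)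
  then have WA: "W \<inter> H_A = {}" and WB: "W \<inter> H_B = {}" and WC: "W \<inter> H_C = {}"
    unfolding W_def H_A H_B H_C_def by auto
  \<comment> \<open>Four disjoint cosets of size \<open>2 ^ (n - 1)\<close> exhaust a space of size
    \<open>2 ^ (n + 1)\<close>.\<close>
  have cover: "W \<union> H_A \<union> H_B \<union> H_C = UNIV"
  proof (rule card_subset_eq)
    have "card (W \<union> H_A \<union> H_B \<union> H_C) = 4 * 2 ^ (n - 1)"
      using cW cA(1) cB(1) cC(1) AB AC BC WA WB WC
      by (simp add: card_Un_disjoint Int_Un_distrib2)
    also have "\<dots> = (2::nat) ^ (n + 1)"
      using dimension(2) by (cases n) auto
    also have "\<dots> = card (UNIV :: (bit ^ 'd) set)"
      using dimension(1) by (simp add: UNIV_bit flip: numeral_2_eq_2 mult_2)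
    finally show "card (W \<union> H_A \<union> H_B \<union> H_C) = card (UNIV :: (bit ^ 'd) set)" .
  qed auto

  \<comment> \<open>The cap inside the cosets\<close>
  have c0: "c0 \<in> H_C" "c0 \<in> S"
    using K_C(2) H_inf(4) unfolding H_C_def by auto
  have S_iff: "s \<in> S \<longleftrightarrow> s \<in> A \<or> s \<in> B \<or> s = c0" for s
  proof -
    have "s \<notin> W" if "s \<in> S"
      using that cap H_inf(4) unfolding pg_cap_iff W_def by blast
    moreover have "s = c0" if "s \<in> S" "s \<in> H_C"
      using that K_C(2) unfolding H_C_def by blast
    ultimately show ?thesis
      using cover c0 unfolding A B by blast
  qed
  have AA: "A \<subseteq> H_A" and BB: "B \<subseteq> H_B" unfolding A B by auto
  \<comment> \<open>The quotient by \<open>W\<close> is a Klein four-group, in which adding the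
    class \<open>H_C\<close> interchanges \<open>H_A\<close> and \<open>H_B\<close>. Each direction
    excludes three of the four cosets.\<close>
  have C_add: "c + x \<in> H_B \<longleftrightarrow> x \<in> H_A" if "c \<in> H_C" for c x
  proof -
    have 1: "c + a \<in> H_B" if a: "a \<in> H_A" for a
    proof -
      have "c + a \<notin> W" using cC(2) [OF \<open>c \<in> H_C\<close>] a AC by blast
      moreover have "c + a \<notin> H_C"
        using cC(2) [OF \<open>c \<in> H_C\<close>, of "c + a"] a WA by auto
      moreover have "c + a \<notin> H_A"
        using cA(2) [OF a, of "c + a"] \<open>c \<in> H_C\<close> WC by auto
      ultimately show ?thesis using cover by blast
    qed
    have 2: "x \<in> H_A" if b: "c + x \<in> H_B"
    proof -
      have "x \<notin> W" using cC(2) [OF \<open>c \<in> H_C\<close>, of "c + x"] b BC by auto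
      moreover have "x \<notin> H_C" using cC(2) [OF \<open>c \<in> H_C\<close>, of x] b WB by auto
      moreover have "x \<notin> H_B" using cB(2) [OF b, of x] \<open>c \<in> H_C\<close> WC
        by (auto simp: add.assoc)
      ultimately show ?thesis using cover by blast
    qed
    show ?thesis using 1 2 by blast
  qed
  have B_iff: "b \<in> B \<longleftrightarrow> b \<in> H_B \<and> c0 + b \<notin> A" for b
    using B'_translate BB unfolding B' by (auto simp: mem_translate_iff set_eq_iff)
  have B_iff': "c0 + x \<in> B \<longleftrightarrow> x \<in> H_A \<and> x \<notin> A" for x
    by (simp add: B_iff C_add c0)
  have H_shift: "w + x \<in> H_A \<longleftrightarrow> x \<in> H_A" "w + x \<in> H_B \<longleftrightarrow> x \<in> H_B" if "w \<in> W" for w x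
    using cA(2) [of x "w + x"] cA(2) [of "w + x" x] cB(2) [of x "w + x"] cB(2) [of "w + x" x] that
    by (auto simp: add.assoc)

  \<comment> \<open>Periods of \<open>A\<close> and \<open>B\<close>\<close>
  have "W \<noteq> {0}"
    using cW dimension(2) one_less_power [of "2::nat" "n - 1"] by auto
  \<comment> \<open>\<open>w0\<close> serves as a period when \<open>A\<close> or \<open>B\<close>
    is empty.\<close>
  then obtain w0 where w0: "w0 \<in> W" "w0 \<noteq> 0" using W(2) by blast
  have perA: "pg_periodic A \<longleftrightarrow> (\<exists>w\<in>W. w \<noteq> 0 \<and> (\<forall>x\<in>A. w + x \<in> A))"
  proof (cases "A = {}")
    case True
    then show ?thesis using w0 by (auto simp: pg_periodic_iff)
  next
    case False
    \<comment> \<open>For some \<open>x\<close> in \<open>A\<close>, both \<open>x\<close> and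
      \<open>v + x\<close> lie in the coset \<open>H_A\<close>, so their sum \<open>v\<close> lies
      in \<open>W\<close>.\<close>
    have "v \<in> W" if "\<forall>x\<in>A. v + x \<in> A" for v
      using False that AA cA(2) by (metis subsetD ex_in_conv vec_bit_add_cancel_outer)
    then show ?thesis by (auto simp: pg_periodic_iff)
  qed
  have perB: "pg_periodic B \<longleftrightarrow> (\<exists>w\<in>W. w \<noteq> 0 \<and> (\<forall>x\<in>B. w + x \<in> B))"
  proof (cases "B = {}")
    case True
    then show ?thesis using w0 by (auto simp: pg_periodic_iff)
  next
    case False
    have "v \<in> W" if "\<forall>x\<in>B. v + x \<in> B" for v
      using False that BB cB(2) by (metis subsetD ex_in_conv vec_bit_add_cancel_outer)
    then show ?thesis by (auto simp: pg_periodic_iff)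
  qed
  \<comment> \<open>\<open>B\<close> is the complement of \<open>c0 + A\<close> in
    \<open>H_B\<close>, and the involution given by \<open>w\<close> preserves a subset of
    \<open>H_B\<close> exactly when it preserves the complement.\<close>
  have shift_iff: "(\<forall>x\<in>A. w + x \<in> A) \<longleftrightarrow> (\<forall>x\<in>B. w + x \<in> B)" if w: "w \<in> W" for w
  proof
    assume L: "\<forall>x\<in>A. w + x \<in> A"
    show "\<forall>x\<in>B. w + x \<in> B"
    proof
      fix x assume "x \<in> B"
      moreover have "c0 + x \<in> A" if "c0 + (w + x) \<in> A"
        using L that by (metis add.left_commute vec_bit_add_self_left)
      ultimately show "w + x \<in> B"
        using H_shift(2) [OF w] by (auto simp: B_iff)
    qed
  next
    assume R: "\<forall>x\<in>B. w + x \<in> B"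
    show "\<forall>x\<in>A. w + x \<in> A"
    proof
      fix x assume x: "x \<in> A"
      have "c0 + x \<in> B" if "c0 + (w + x) \<in> B"
        using R that by (metis add.left_commute vec_bit_add_self_left)
      then show "w + x \<in> A"
        using x AA H_shift(1) [OF w] by (auto simp: B_iff')
    qed
  qed
  have periodic_iff: "pg_periodic A \<longleftrightarrow> pg_periodic B"
    unfolding perA perB using shift_iff by blast

  \<comment> \<open>Points covered by secants\<close>
  have card_AB: "card A + card B = 2 ^ (n - 1)"
  proof -
    have "card (H_B - B) = card A"
      using B'_translate by (simp add: B' card_image)
    then show ?thesis
      using cB(1) BB card_mono [of H_B B] by (simp add: card_Diff_subset)
  qed
  have inf_covered: "\<exists>x\<in>S. w + x \<in> S" if w: "w \<in> W" for w
  proof -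
    \<comment> \<open>By \<open>card_A\<close>, the set \<open>A\<close> is not exactly half of its
      coset, so by \<open>card_AB\<close> one of \<open>A\<close> and \<open>B\<close> exceeds half.
      Here \<open>n \<ge> 2\<close> keeps the exponent \<open>n - 2\<close> from truncating.\<close>
    have "(2::nat) ^ (n - 1) = 2 * 2 ^ (n - 2)"
      using dimension(2) by (simp add: Suc_diff_Suc numeral_2_eq_2 flip: power_Suc)
    then consider "card H_A < 2 * card A" | "card H_B < 2 * card B"
      using card_A card_AB cA(1) cB(1) by linarith
    then show ?thesis
    proof cases
      case 1
      then show ?thesis
        using exists_translate_pair [OF AA, of w] H_shift(1) [OF w] S_iff by auto
    next
      case 2
      then show ?thesis
        using exists_translate_pair [OF BB, of w] H_shift(2) [OF w] S_iff by auto
    qed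
  qed
  have AB_covered: "\<exists>x\<in>S. w + x \<in> S" if w: "w \<in> H_A \<union> H_B" "w \<notin> S" for w
  proof -
    have "c0 + w \<in> S"
      using w S_iff B_iff [of w] B_iff' [of w] by blast
    then show ?thesis using c0 by (metis add.commute)
  qed
  have C_covered: "(\<exists>x\<in>S. (c0 + h) + x \<in> S) \<longleftrightarrow> \<not> (\<forall>x\<in>A. h + x \<in> A)"
    if h: "h \<in> W" "h \<noteq> 0" for h
  proof -
    have c: "c0 + h \<in> H_C" "c0 + h \<noteq> c0"
      using cC(2) [OF c0(1), of "c0 + h"] h by auto
    \<comment> \<open>Adding \<open>c0 + h\<close> to \<open>x\<close> lands in \<open>B\<close>
      exactly when \<open>h + x\<close> is in the part of \<open>H_A\<close> missed by
      \<open>A\<close>; this turns coverage into a statement about the shift by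
      \<open>h\<close>.\<close>
    have eq: "c0 + h + x \<in> B \<longleftrightarrow> x \<in> H_A \<and> h + x \<notin> A" for x
      using B_iff' [of "h + x"] H_shift(1) [OF h(1)] by (simp add: add.assoc)
    have A_case: "c0 + h + x \<in> S \<longleftrightarrow> h + x \<notin> A" if "x \<in> A" for x
    proof -
      have "c0 + h + x \<in> H_B" using C_add [OF c(1)] that AA by blast
      then have "c0 + h + x \<notin> A" "c0 + h + x \<noteq> c0"
        using AA AB BC c0(1) by (blast, metis disjoint_iff)
      then show ?thesis using eq [of x] that AA S_iff [of "c0 + h + x"] by blast
    qed
    have B_case: "c0 + h + x \<in> A" if x: "x \<in> B" "c0 + h + x \<in> S" for x
    proof -
      have "c0 + h + x \<in> H_A"
        using C_add [OF c(1), of "c0 + h + x"] x(1) BB by (metis subsetD vec_bit_add_self_left)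
      then have "c0 + h + x \<notin> B" "c0 + h + x \<noteq> c0"
        using AB AC BB c0(1) by (blast, metis disjoint_iff)
      then show ?thesis using x(2) S_iff by metis
    qed
    \<comment> \<open>A secant through \<open>c0\<close> is impossible: its other point would be
      \<open>h\<close>, which lies in \<open>W\<close> and hence outside \<open>S\<close>.\<close>
    have "c0 + h + c0 = h" by (simp add: add.assoc)
    moreover have "h \<notin> S"
      using h S_iff [of h] AA BB WA WB WC c0 by blast
    ultimately have C_case: "c0 + h + c0 \<notin> S" by simp
    \<comment> \<open>Swapping the two points of the secant if necessary, the first one may be taken
      in \<open>A\<close>.\<close>
    have "\<exists>x\<in>A. c0 + h + x \<in> S" if x: "x \<in> S" "c0 + h + x \<in> S" for x
    proof -
      consider "x \<in> A" | "x \<in> B" | "x = c0"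
        using x(1) S_iff [of x] by blast
      then show ?thesis
      proof cases
        case 2
        then show ?thesis
          using B_case [OF 2 x(2)] x(1) by (metis vec_bit_add_self_left)
      qed (use x C_case in blast)+
    qed
    then have "(\<exists>x\<in>S. c0 + h + x \<in> S) \<longleftrightarrow> (\<exists>x\<in>A. c0 + h + x \<in> S)"
      using A by blast
    then show ?thesis using A_case by blast
  qed

  \<comment> \<open>Completeness against the periods of \<open>A\<close>\<close>
  have "pg_complete_cap S \<longleftrightarrow> \<not> (\<exists>h\<in>W. h \<noteq> 0 \<and> (\<forall>x\<in>A. h + x \<in> A))"
  proof
    assume complete: "pg_complete_cap S"
    have "\<not> (\<forall>x\<in>A. h + x \<in> A)" if h: "h \<in> W" "h \<noteq> 0" for h
    proof -
      have "c0 + h \<in> H_C" "c0 + h \<noteq> c0"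
        using cC(2) [OF c0(1), of "c0 + h"] h by auto
      then have "c0 + h \<noteq> 0" "c0 + h \<notin> S"
        using W(2) WC S_iff [of "c0 + h"] AA BB AC BC by (metis disjoint_iff, blast)
      then show ?thesis
        using complete C_covered [OF h] pg_complete_cap_iff [OF cap] by blast
    qed
    then show "\<not> (\<exists>h\<in>W. h \<noteq> 0 \<and> (\<forall>x\<in>A. h + x \<in> A))" by blast
  next
    assume *: "\<not> (\<exists>h\<in>W. h \<noteq> 0 \<and> (\<forall>x\<in>A. h + x \<in> A))"
    have "\<exists>x\<in>S. w + x \<in> S" if w: "w \<noteq> 0" "w \<notin> S" for w
    proof (cases "w \<in> H_C")
      case True
      \<comment> \<open>Any \<open>w\<close> in \<open>H_C\<close> other than \<open>c0\<close> has
        the form \<open>c0 + h\<close> with \<open>h = c0 + w\<close> nonzero in \<open>W\<close>,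
        so \<open>C_covered\<close> applies.\<close>
      have "c0 + w \<in> W" using cC(2) [OF c0(1)] True by blast
      moreover have "c0 + w \<noteq> 0"
        using w c0 by (metis add.right_neutral vec_bit_add_self_left)
      ultimately show ?thesis
        using C_covered [of "c0 + w"] * by auto
    next
      case False
      then show ?thesis using cover inf_covered AB_covered w by blast
    qed
    then show "pg_complete_cap S" using pg_complete_cap_iff [OF cap] by blast
  qed
  then show ?thesis using perA periodic_iff by blast
qed

end
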